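(* Let $\lambda$ be a nonzero real number. For any integers $n,k$ with $1\le k\le n$, we have $$T_{2,\lambda}(n+1,k)=\Big(\frac{k}{2}-n\lambda\Big)T_{2,\lambda}(n,k)+T_{2,\lambda}\Big(n,k-1\,\Big|\,-\frac12\Big).$$
   Context: All generating functions are formal power series in $t$; for real $y$, $(1+\lambda t)^{y/\lambda}=\sum_{m\ge 0}(y)_{m,\lambda}\frac{t^m}{m!}$, where $(y)_{0,\lambda}=1$ and $(y)_{m,\lambda}=y(y-\lambda)\cdots(y-(m-1)\lambda)$ for $m\ge1$. For a nonnegative integer $k$ and real $x$, the degenerate central factorial polynomials of the second kind $T_{2,\lambda}(n,k\mid x)$ $(n\ge k)$ are defined by $$\frac{1}{k!}(1+\lambda t)^{\frac{x}{\lambda}}\Big((1+\lambda t)^{\frac{1}{2\lambda}}-(1+\lambda t)^{-\frac{1}{2\lambda}}\Big)^k=\sum_{n=k}^\infty T_{2,\lambda}(n,k\mid x)\frac{t^n}{n!},$$ and the degenerate central factorial numbers of the second kind are $T_{2,\lambda}(n,k)=T_{2,\lambda}(n,k\mid 0)$. *)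

theory Defs
  imports Complex_Main "HOL-Computational_Algebra.Formal_Power_Series"
begin

definition degenerate_falling_factorial :: "real \<Rightarrow> real \<Rightarrow> nat \<Rightarrow> real" where
  "degenerate_falling_factorial l y m = (\<Prod>i<m. y - real i * l)"

(* The formal power series (1 + l t)^(y/l) in t. *)
definition degenerate_exp :: "real \<Rightarrow> real \<Rightarrow> real fps" where
  "degenerate_exp l y = Abs_fps (\<lambda>m. degenerate_falling_factorial l y m / fact m)"

definition T2_gen_fun :: "real \<Rightarrow> nat \<Rightarrow> real \<Rightarrow> real fps" where
  "T2_gen_fun l k x =
     fps_const (1 / fact k) * degenerate_exp l x
       * (degenerate_exp l (1/2) - degenerate_exp l (- (1/2))) ^ k"

(* T2 l n k x is T_{2,l}(n, k | x).  It is introduced for all n; by T2_gen_fun_expansion below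
   it vanishes for n < k, so the generating function is a series over n \<ge> k only. *)
definition T2 :: "real \<Rightarrow> nat \<Rightarrow> nat \<Rightarrow> real \<Rightarrow> real" where
  "T2 l n k x = fact n * fps_nth (T2_gen_fun l k x) n"

definition T2_number :: "real \<Rightarrow> nat \<Rightarrow> nat \<Rightarrow> real" where
  "T2_number l n k = T2 l n k 0"

lemma T2_gen_fun_expansion:
  "T2_gen_fun l k x = Abs_fps (\<lambda>n. if k \<le> n then T2 l n k x / fact n else 0)"
proof (rule fps_ext)
  fix n
  have z: "fps_nth (degenerate_exp l (1/2) - degenerate_exp l (- (1/2))) 0 = 0"
    by (simp add: degenerate_exp_def degenerate_falling_factorial_def)
  have "fps_nth (T2_gen_fun l k x) n = 0" if "n < k"
    unfolding T2_gen_fun_def fps_mult_nth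
    by (rule sum.neutral) (use startsby_zero_power_prefix[OF z, of k] that in auto)
  then show "fps_nth (T2_gen_fun l k x) n =
      fps_nth (Abs_fps (\<lambda>n. if k \<le> n then T2 l n k x / fact n else 0)) n"
    by (auto simp: T2_def)
qed

end

theory Submission
  imports Defs
begin

text \<open>
  Write \<open>E y\<close> for \<open>(1 + l t)\<close> to the power \<open>y / l\<close>.  The differential operator
  \<open>\<theta> = (1 + l t) d/dt\<close> is a derivation for which \<open>E y\<close> is an eigenvector with eigenvalue \<open>y\<close>.
  So for \<open>D = E (1/2) - E (-1/2)\<close> one gets
  \<open>\<theta> D = (E (1/2) + E (-1/2)) / 2 = D / 2 + E (-1/2)\<close>, and the Leibniz rule gives
  \<open>\<theta> (D ^ k / k!) = (k/2) D ^ k / k! + E (-1/2) D ^ (k - 1) / (k - 1)!\<close>.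
  On exponential coefficients \<open>a n\<close>, \<open>\<theta>\<close> acts as \<open>a n \<mapsto> a (n + 1) + n l a n\<close>; comparing them on
  both sides is the recurrence.  The asymmetric way of writing \<open>\<theta> D\<close> is what produces the
  argument \<open>-1/2\<close>.
\<close>

text \<open>
  The summand \<open>l t d/dt\<close> preserves degrees and multiplies the coefficient of \<open>t\<close> to the \<open>n\<close> by \<open>n l\<close>;
  this is the source of the term \<open>- n l\<close> in the recurrence.
\<close>

lemma fps_nth_degenerate_derivation:
  fixes F :: "real fps"
  shows "fact n * fps_nth ((1 + fps_const l * fps_X) * fps_deriv F) n
           = fact (n + 1) * fps_nth F (n + 1) + real n * l * (fact n * fps_nth F n)"
proof -
  have "fps_nth ((1 + fps_const l * fps_X) * fps_deriv F) n
          = real (n + 1) * fps_nth F (n + 1) + l * (real n * fps_nth F n)"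
    by (cases n) (simp_all add: distrib_right mult.assoc)
  then show ?thesis
    by (simp add: algebra_simps)
qed

text \<open>
  In coefficients, the falling factorial of length \<open>n + 1\<close> is \<open>y - n l\<close> times the one of length
  \<open>n\<close>, and the term \<open>- n l\<close> cancels against the contribution of \<open>l t d/dt\<close>.
\<close>

lemma degenerate_exp_eigenvector:
  "(1 + fps_const l * fps_X) * fps_deriv (degenerate_exp l y) = fps_const y * degenerate_exp l y"
proof (rule fps_ext)
  fix n
  have "fact n * fps_nth ((1 + fps_const l * fps_X) * fps_deriv (degenerate_exp l y)) n
          = fact n * fps_nth (fps_const y * degenerate_exp l y) n"
    unfolding fps_nth_degenerate_derivation
    by (simp add: degenerate_exp_def degenerate_falling_factorial_def field_simps
        del: fact_Suc)
  then show "fps_nth ((1 + fps_const l * fps_X) * fps_deriv (degenerate_exp l y)) n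
          = fps_nth (fps_const y * degenerate_exp l y) n"
    by simp
qed

lemma degenerate_exp_0: "degenerate_exp l 0 = 1"
proof (rule fps_ext)
  fix n
  show "fps_nth (degenerate_exp l 0) n = fps_nth 1 n"
    by (cases n)
      (simp_all add: degenerate_exp_def degenerate_falling_factorial_def
        prod.lessThan_Suc_shift del: prod.lessThan_Suc)
qed

lemma degenerate_derivation_T2_gen_fun:
  "(1 + fps_const l * fps_X) * fps_deriv (T2_gen_fun l (Suc j) 0)
     = fps_const (real (Suc j) / 2) * T2_gen_fun l (Suc j) 0 + T2_gen_fun l j (- (1/2))"
proof -
  let ?p = "1 + fps_const l * fps_X"
  let ?E = "degenerate_exp l (- (1/2))"
  let ?D = "degenerate_exp l (1/2) - ?E"
  let ?c = "fps_const (1 / fact (Suc j) :: real)"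
  have "?p * fps_deriv ?D
          = fps_const (1/2) * degenerate_exp l (1/2) - fps_const (- (1/2)) * ?E"
    by (simp only: fps_deriv_sub right_diff_distrib degenerate_exp_eigenvector)
  also have "\<dots> = fps_const (1/2) * ?D + ?E"
    by (rule fps_ext) (simp add: algebra_simps)
  finally have D: "?p * fps_deriv ?D = fps_const (1/2) * ?D + ?E" .
  have "fps_deriv (T2_gen_fun l (Suc j) 0) = ?c * (fps_const (real (Suc j)) * fps_deriv ?D * ?D ^ j)"
    by (simp add: T2_gen_fun_def degenerate_exp_0 fps_deriv_power del: fps_const_mult power_Suc)
  then have "?p * fps_deriv (T2_gen_fun l (Suc j) 0)
          = ?c * fps_const (real (Suc j)) * (?p * fps_deriv ?D) * ?D ^ j"
    by (simp only: ac_simps)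
  also have "\<dots> = fps_const (real (Suc j)) * fps_const (1/2) * (?c * ?D ^ Suc j)
                   + ?c * fps_const (real (Suc j)) * (?E * ?D ^ j)"
    unfolding D by (simp only: power_Suc distrib_left distrib_right ac_simps)
  also have "fps_const (real (Suc j)) * fps_const (1/2) = fps_const (real (Suc j) / 2)"
    by simp
  also have "?c * fps_const (real (Suc j)) = fps_const (1 / fact j)"
    by (simp add: divide_simps)
  finally show ?thesis
    by (simp only: T2_gen_fun_def degenerate_exp_0 mult_1_right mult.assoc)
qed

theorem theorem0p5:
  fixes l :: real and n k :: nat
  assumes "l \<noteq> 0" and "1 \<le> k" and "k \<le> n"
  shows "T2_number l (n + 1) k =
           (real k / 2 - real n * l) * T2_number l n k + T2 l n (k - 1) (- (1/2))"
proof -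
  obtain j where k: "k = Suc j"
    using \<open>1 \<le> k\<close> by (cases k) auto
  have "T2_number l (n + 1) k + real n * l * T2_number l n k
          = fact n * fps_nth ((1 + fps_const l * fps_X) * fps_deriv (T2_gen_fun l k 0)) n"
    unfolding fps_nth_degenerate_derivation T2_number_def T2_def ..
  also have "\<dots> = real k / 2 * T2_number l n k + T2 l n (k - 1) (- (1/2))"
    unfolding k degenerate_derivation_T2_gen_fun
    by (simp add: T2_number_def T2_def algebra_simps)
  finally show ?thesis
    by (simp add: algebra_simps)
qed

end
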